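(* Let $0<q<1$, $\alpha\in\mathbb{R}$ with $|\alpha|>1$, $\lambda>0$, $j\in\mathbb{N}$, and let $\{\mathbb{H}_n(x;q)\}_{n\ge0}$ be the $q$-Hermite I-Sobolev type polynomials. Then for every integer $n\ge1$ the following identity of rational functions in $x$ holds: $$\mathbb{H}_n(x;q)=\mathcal{E}_{1,n}(x)\,H_n(x;q)+\mathcal{F}_{1,n}(x)\,H_{n-1}(x;q),$$ where $$\mathcal{E}_{1,n}(x)=1-\lambda\frac{[n]_q^{(j)}H_{n-j}(\alpha;q)}{1+\lambda K_{n-1,q}^{(j,j)}(\alpha,\alpha)}\,\mathcal{A}_n^{(j)}(x,\alpha),\qquad \mathcal{F}_{1,n}(x)=-\lambda\frac{[n]_q^{(j)}H_{n-j}(\alpha;q)}{1+\lambda K_{n-1,q}^{(j,j)}(\alpha,\alpha)}\,\mathcal{B}_n^{(j)}(x,\alpha).$$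
   Context: Here $\mathbb{N}=\{0,1,2,\dots\}$ and $0<q<1$. Notation: $[n]_q=\frac{1-q^n}{1-q}$, $[0]_q!=1$, $[n]_q!=[n]_q\cdots[1]_q$; $(a;q)_n=\prod_{i=0}^{n-1}(1-aq^i)$ (also for $n=\infty$), $(a_1,\dots,a_r;q)_n=\prod_i(a_i;q)_n$; $[n]_q^{(k)}=\frac{(q^{-n};q)_k}{(q-1)^k}q^{kn-\binom{k}{2}}$ (equal to $[n]_q[n-1]_q\cdots[n-k+1]_q$). The $q$-derivative is $D_qf(x)=\frac{f(qx)-f(x)}{(q-1)x}$ for $x\ne0$ (and $f'(0)$ at $x=0$), $D_q^0f=f$, $D_q^k=D_q D_q^{k-1}$. The $q$-subtraction power is $(x\boxminus_q y)^m=\sum_{k=0}^m\frac{[m]_q!}{[k]_q![m-k]_q!}q^{\binom{k}{2}}(-y)^kx^{m-k}$ (equal to $\prod_{i=0}^{m-1}(x-q^iy)$). Monic $q$-Hermite I polynomials: $H_n(x;q)=q^{\binom n2}\sum_{k=0}^n\frac{(q^{-n};q)_k(x^{-1};q)_k}{(q;q)_k}(-qx)^k$ for $n\ge0$, and $H_m=0$ for $m<0$; equivalently $H_0=1$, $xH_n=H_{n+1}+\gamma_nH_{n-1}$ with $\gamma_n=q^{n-1}(1-q^n)$. Put $\|H_n\|^2=(1-q)(q;q)_n(q,-1,-q;q)_\infty q^{\binom n2}$ and $K_{n,q}^{(i,l)}(x,y)=\sum_{k=0}^n\frac{(D_q^iH_k)(x;q)\,(D_q^lH_k)(y;q)}{\|H_k\|^2}$.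 Sobolev inner product (on real polynomials): $\langle f,g\rangle_\lambda=\int_{-1}^1f(x)g(x)(qx,-qx;q)_\infty d_qx+\lambda (D_q^jf)(\alpha)(D_q^jg)(\alpha)$, where $\int_{-1}^1h(t)d_qt=(1-q)\sum_{m\ge0}q^m\big(h(q^m)+h(-q^m)\big)$. $\mathbb{H}_n(x;q)$ is the monic polynomial of degree $n$, $\{\mathbb{H}_n\}$ being orthogonal with respect to $\langle\cdot,\cdot\rangle_\lambda$. For $n\ge1$ put $\mathcal{A}_n^{(j)}(x,y)=\frac{[j]_q!}{\|H_{n-1}\|^2(x\boxminus_qy)^{j+1}}\sum_{k=0}^j\frac{(D_q^kH_{n-1})(y;q)}{[k]_q!}(x\boxminus_qy)^k$, $\mathcal{B}_n^{(j)}(x,y)=-\frac{[j]_q!}{\|H_{n-1}\|^2(x\boxminus_qy)^{j+1}}\sum_{k=0}^j\frac{(D_q^kH_{n})(y;q)}{[k]_q!}(x\boxminus_qy)^k$. *)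

theory Defs
  imports "HOL-Analysis.Analysis" "HOL-Computational_Algebra.Polynomial"
begin

definition qnum :: "real \<Rightarrow> nat \<Rightarrow> real" where
  "qnum q n = (1 - q ^ n) / (1 - q)"

definition qfact :: "real \<Rightarrow> nat \<Rightarrow> real" where
  "qfact q n = (\<Prod>i=1..n. qnum q i)"

definition qpoch :: "real \<Rightarrow> real \<Rightarrow> nat \<Rightarrow> real" where
  "qpoch a q n = (\<Prod>i<n. 1 - a * q ^ i)"

definition qpoch_inf :: "real \<Rightarrow> real \<Rightarrow> real" where
  "qpoch_inf a q = (\<Prod>i. 1 - a * q ^ i)"

text \<open>The \<open>q\<close>-falling factorial. The exponent of the power of \<open>q\<close> is an integer,
  as \<open>k * n - (k choose 2)\<close> is negative for large \<open>k\<close>.\<close>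

definition qfalling :: "real \<Rightarrow> nat \<Rightarrow> nat \<Rightarrow> real" where
  "qfalling q n k =
     qpoch (q powi (- int n)) q k / (q - 1) ^ k * q powi (int (k * n) - int (k choose 2))"

definition qderiv :: "real \<Rightarrow> (real \<Rightarrow> real) \<Rightarrow> real \<Rightarrow> real" where
  "qderiv q f x = (if x = 0 then deriv f 0 else (f (q * x) - f x) / ((q - 1) * x))"

abbreviation qderiv_iter :: "real \<Rightarrow> nat \<Rightarrow> (real \<Rightarrow> real) \<Rightarrow> real \<Rightarrow> real" where
  "qderiv_iter q k \<equiv> qderiv q ^^ k"

definition qsub_pow :: "real \<Rightarrow> real \<Rightarrow> real \<Rightarrow> nat \<Rightarrow> real" where
  "qsub_pow q x y m =
     (\<Sum>k\<le>m. qfact q m / (qfact q k * qfact q (m - k)) * q ^ (k choose 2) * (- y) ^ k * x ^ (m - k))"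

text \<open>In the basic hypergeometric formula for the monic \<open>q\<close>-Hermite I polynomials the factor
  \<open>(x\<inverse>; q)\<^sub>k x\<^sup>k\<close> is the polynomial with factors \<open>x - q\<^sup>i\<close>, \<open>i < k\<close>; see \<open>poly_qHermite\<close> below.\<close>

definition qHermite :: "real \<Rightarrow> nat \<Rightarrow> real poly" where
  "qHermite q n = smult (q ^ (n choose 2))
     (\<Sum>k\<le>n. smult (qpoch (q powi (- int n)) q k / qpoch q q k * (- q) ^ k)
       (\<Prod>i<k. [:- (q ^ i), 1:]))"

lemma poly_qHermite:
  assumes "x \<noteq> 0"
  shows "poly (qHermite q n) x = q ^ (n choose 2) *
    (\<Sum>k\<le>n. qpoch (q powi (- int n)) q k * qpoch (inverse x) q k / qpoch q q k * (- (q * x)) ^ k)"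
proof -
  have "(\<Prod>i<k. x - q ^ i) = qpoch (inverse x) q k * x ^ k" for k
    using assms by (induction k) (auto simp: qpoch_def field_simps)
  moreover have "(- (q * x)) ^ k = (- q) ^ k * x ^ k" for k
    by (metis mult_minus_left power_mult_distrib)
  ultimately show ?thesis
    by (simp add: qHermite_def poly_sum poly_prod mult_ac)
qed

definition qHermite_int :: "real \<Rightarrow> int \<Rightarrow> real poly" where
  "qHermite_int q m = (if m < 0 then 0 else qHermite q (nat m))"

definition qHermite_norm2 :: "real \<Rightarrow> nat \<Rightarrow> real" where
  "qHermite_norm2 q n = (1 - q) * qpoch q q n
     * (qpoch_inf q q * qpoch_inf (-1) q * qpoch_inf (- q) q) * q ^ (n choose 2)"

definition qkernel :: "real \<Rightarrow> nat \<Rightarrow> nat \<Rightarrow> nat \<Rightarrow> real \<Rightarrow> real \<Rightarrow> real" where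
  "qkernel q n i l x y =
     (\<Sum>k\<le>n. qderiv_iter q i (poly (qHermite q k)) x * qderiv_iter q l (poly (qHermite q k)) y
       / qHermite_norm2 q k)"

definition jackson_integral :: "real \<Rightarrow> (real \<Rightarrow> real) \<Rightarrow> real" where
  "jackson_integral q h = (1 - q) * (\<Sum>m. q ^ m * (h (q ^ m) + h (- (q ^ m))))"

definition sobolev_inner ::
  "real \<Rightarrow> real \<Rightarrow> real \<Rightarrow> nat \<Rightarrow> real poly \<Rightarrow> real poly \<Rightarrow> real" where
  "sobolev_inner q \<alpha> lam j f g =
     jackson_integral q (\<lambda>x. poly f x * poly g x * (qpoch_inf (q * x) q * qpoch_inf (- (q * x)) q))
     + lam * qderiv_iter q j (poly f) \<alpha> * qderiv_iter q j (poly g) \<alpha>"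

definition qHermite_sobolev_type ::
  "real \<Rightarrow> real \<Rightarrow> real \<Rightarrow> nat \<Rightarrow> (nat \<Rightarrow> real poly) \<Rightarrow> bool" where
  "qHermite_sobolev_type q \<alpha> lam j P \<longleftrightarrow>
     (\<forall>n. degree (P n) = n \<and> lead_coeff (P n) = 1) \<and>
     (\<forall>m n. m \<noteq> n \<longrightarrow> sobolev_inner q \<alpha> lam j (P m) (P n) = 0)"

text \<open>The coefficient functions below are used for \<open>n \<ge> 1\<close> only, and away from the zeros of
  \<open>qsub_pow q x y (j + 1)\<close>.\<close>

definition calA :: "real \<Rightarrow> nat \<Rightarrow> nat \<Rightarrow> real \<Rightarrow> real \<Rightarrow> real" where
  "calA q j n x y =
     qfact q j / (qHermite_norm2 q (n - 1) * qsub_pow q x y (j + 1)) *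
     (\<Sum>k\<le>j. qderiv_iter q k (poly (qHermite q (n - 1))) y / qfact q k * qsub_pow q x y k)"

definition calB :: "real \<Rightarrow> nat \<Rightarrow> nat \<Rightarrow> real \<Rightarrow> real \<Rightarrow> real" where
  "calB q j n x y =
     - (qfact q j / (qHermite_norm2 q (n - 1) * qsub_pow q x y (j + 1))) *
     (\<Sum>k\<le>j. qderiv_iter q k (poly (qHermite q n)) y / qfact q k * qsub_pow q x y k)"

definition calE1 :: "real \<Rightarrow> real \<Rightarrow> real \<Rightarrow> nat \<Rightarrow> nat \<Rightarrow> real \<Rightarrow> real" where
  "calE1 q \<alpha> lam j n x =
     1 - lam * (qfalling q n j * poly (qHermite_int q (int n - int j)) \<alpha>
                / (1 + lam * qkernel q (n - 1) j j \<alpha> \<alpha>)) * calA q j n x \<alpha>"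

definition calF1 :: "real \<Rightarrow> real \<Rightarrow> real \<Rightarrow> nat \<Rightarrow> nat \<Rightarrow> real \<Rightarrow> real" where
  "calF1 q \<alpha> lam j n x =
     - lam * (qfalling q n j * poly (qHermite_int q (int n - int j)) \<alpha>
              / (1 + lam * qkernel q (n - 1) j j \<alpha> \<alpha>)) * calB q j n x \<alpha>"

end

theory Submission imports Defs begin

text \<open>
  The Sobolev form differs from the \<open>q\<close>-Hermite form only by the rank-one term
  \<open>\<lambda> (D\<^sub>q\<^sup>j f)(\<alpha>) (D\<^sub>q\<^sup>j g)(\<alpha>)\<close>. Hence the \<open>H\<^sub>k\<close>-coefficient of \<open>P\<^sub>n - H\<^sub>n\<close> is a multiple of
  \<open>(D\<^sub>q\<^sup>j H\<^sub>k)(\<alpha>) / \<parallel>H\<^sub>k\<parallel>\<^sup>2\<close> with a factor independent of \<open>k\<close>, so that \<open>P\<^sub>n\<close> is \<open>H\<^sub>n\<close> minus a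
  constant times a \<open>q\<close>-derivative of the reproducing kernel. Applying \<open>D\<^sub>q\<^sup>j\<close> at \<open>\<alpha>\<close> determines the
  constant (\<open>sobolev_type_kernel_expansion\<close>). The kernel itself is a quotient with denominator
  \<open>x - y\<close> (\<open>christoffel_darboux\<close>). Differentiating \<open>j\<close> times in \<open>y\<close> need not touch that quotient:
  if \<open>F(y) = (x - y) G(y)\<close>, the Leibniz rule expresses \<open>D\<^sub>q\<^sup>k F\<close> by \<open>D\<^sub>q\<^sup>k G\<close> and \<open>D\<^sub>q\<^sup>k\<^sup>-\<^sup>1 G\<close>, and the
  \<open>q\<close>-Taylor sum of \<open>F\<close> telescopes to a multiple of \<open>D\<^sub>q\<^sup>j G\<close> (\<open>qtaylor_linear_mult\<close>). This sum
  is what the coefficient functions \<open>calA\<close> and \<open>calB\<close> contain.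

  Orthogonality with the stated norms enters through the moment functional \<open>L\<close> of the weight.
  As the weight satisfies a first-order \<open>q\<close>-difference equation, a telescoping Jackson sum gives
  \<open>L(x p) = (1 - q) L(D\<^sub>q p)\<close> (\<open>qmoment_by_parts\<close>). With \<open>D\<^sub>q H\<^sub>n = [n]\<^sub>q H\<^sub>n\<^sub>-\<^sub>1\<close> and the three-term
  recurrence this yields \<open>L(H\<^sub>n) = 0\<close> for \<open>n > 0\<close>, and then the recurrence alone propagates
  orthogonality to all pairs. The same rule computes the even moments as multiples of \<open>L(1)\<close>;
  letting the degree tend to infinity isolates the two mass points \<open>x = 1\<close> and \<open>x = -1\<close>, and this
  evaluates \<open>L(1)\<close> as an infinite product.
\<close>

section \<open>Finite products and the q-binomial theorem\<close>

lemma qpoch_0 [simp]: "qpoch a q 0 = 1"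
  by (simp add: qpoch_def)

lemma qpoch_Suc: "qpoch a q (Suc n) = qpoch a q n * (1 - a * q ^ n)"
  by (simp add: qpoch_def)

lemma qpoch_Suc_shift: "qpoch a q (Suc n) = (1 - a) * qpoch (a * q) q n"
  by (simp add: qpoch_def prod.lessThan_Suc_shift mult.assoc del: prod.lessThan_Suc)

lemma qpoch_q_pos:
  assumes "0 < q" "q < 1"
  shows "qpoch q q n > 0"
  unfolding qpoch_def
proof (rule prod_pos, safe)
  fix i show "0 < 1 - q * q ^ i"
    using power_Suc_less_one[of q i] assms by simp
qed

lemma qnum_pos:
  assumes "0 < q" "q < 1" "n > 0"
  shows "qnum q n > 0"
  using assms by (simp add: qnum_def power_less_one_iff)

lemma qnum_mult: "q \<noteq> 1 \<Longrightarrow> (q - 1) * qnum q n = q ^ n - 1"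
  by (simp add: qnum_def field_simps)

lemma qfact_0 [simp]: "qfact q 0 = 1"
  by (simp add: qfact_def)

lemma qfact_Suc: "qfact q (Suc n) = qnum q (Suc n) * qfact q n"
  by (simp add: qfact_def)

lemma qfact_pos:
  assumes "0 < q" "q < 1"
  shows "qfact q n > 0"
  unfolding qfact_def by (rule prod_pos) (use assms in \<open>auto intro!: qnum_pos\<close>)

lemma choose_two_Suc: "Suc k choose 2 = (k choose 2) + k"
  by (simp add: numeral_2_eq_2)

lemma qsub_pow_0 [simp]: "qsub_pow q x y 0 = 1"
  by (simp add: qsub_pow_def numeral_2_eq_2)

text \<open>This recursion is the \<open>q\<close>-binomial theorem, i.e. the factorization of the \<open>q\<close>-subtraction
  power. Divided by \<open>[m]\<^sub>q!\<close> the power is a convolution of two sequences with first-order recursions;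
  writing \<open>[m + 1]\<^sub>q = [d]\<^sub>q + q\<^sup>d [k]\<^sub>q\<close> for \<open>k + d = m + 1\<close> lets each of the two
  recursions lower one of the two indices.\<close>

lemma qsub_pow_Suc:
  assumes q: "0 < q" "q < 1"
  shows "qsub_pow q x y (Suc m) = (x - q ^ m * y) * qsub_pow q x y m"
proof -
  define a where "a k = q ^ (k choose 2) * (- y) ^ k / qfact q k" for k
  define b where "b d = x ^ d / qfact q d" for d
  have fact: "qfact q k \<noteq> 0" "qnum q (Suc k) \<noteq> 0" for k
    using qfact_pos[OF q] qnum_pos[OF q, of "Suc k"] by (auto simp: less_le)
  have conv: "qsub_pow q x y m = qfact q m * (\<Sum>k\<le>m. a k * b (m - k))" for m
    by (simp add: qsub_pow_def a_def b_def sum_distrib_left mult_ac)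
  have a: "qnum q (Suc k) * a (Suc k) = - (y * q ^ k) * a k" for k
    using fact by (simp add: a_def qfact_Suc choose_two_Suc power_add)
  have b: "qnum q (Suc d) * b (Suc d) = x * b d" for d
    using fact by (simp add: b_def qfact_Suc)
  have z: "qnum q 0 = 0" by (simp add: qnum_def)
  have split: "qnum q (Suc m) = qnum q (Suc m - k) + q ^ (Suc m - k) * qnum q k"
    if "k \<le> Suc m" for k
    using that q by (simp add: qnum_def field_simps flip: power_add)
  have "qnum q (Suc m) * (\<Sum>k\<le>Suc m. a k * b (Suc m - k))
      = (\<Sum>k\<le>Suc m. a k * (qnum q (Suc m - k) * b (Suc m - k)))
      + (\<Sum>k\<le>Suc m. q ^ (Suc m - k) * (qnum q k * a k) * b (Suc m - k))"
    unfolding sum_distrib_left sum.distrib[symmetric]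
    by (rule sum.cong) (use split in \<open>auto simp: algebra_simps\<close>)
  also have "(\<Sum>k\<le>Suc m. a k * (qnum q (Suc m - k) * b (Suc m - k)))
      = (\<Sum>k\<le>m. a k * (x * b (m - k)))"
    by (simp add: z Suc_diff_le b)
  also have "(\<Sum>k\<le>Suc m. q ^ (Suc m - k) * (qnum q k * a k) * b (Suc m - k))
      = (\<Sum>k\<le>m. q ^ (m - k) * (- (y * q ^ k) * a k) * b (m - k))"
    by (subst sum.atMost_Suc_shift) (simp add: z a)
  also have "\<dots> = (\<Sum>k\<le>m. - (q ^ m * y) * (a k * b (m - k)))"
  proof (rule sum.cong[OF refl])
    fix k assume "k \<in> {..m}"
    then have e: "q ^ m = q ^ (m - k) * q ^ k" by (simp flip: power_add)
    show "q ^ (m - k) * (- (y * q ^ k) * a k) * b (m - k) = - (q ^ m * y) * (a k * b (m - k))"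
      unfolding e by simp
  qed
  also have "(\<Sum>k\<le>m. a k * (x * b (m - k))) + \<dots>
      = (x - q ^ m * y) * (\<Sum>k\<le>m. a k * b (m - k))"
    unfolding sum_distrib_left sum.distrib[symmetric]
    by (rule sum.cong) (auto simp: algebra_simps)
  finally show ?thesis
    by (simp add: conv qfact_Suc mult_ac)
qed

lemma qsub_pow_nonzero:
  assumes q: "0 < q" "q < 1" and "\<forall>i<m. x \<noteq> q ^ i * y"
  shows "qsub_pow q x y m \<noteq> 0"
  using assms(3) by (induction m) (auto simp: qsub_pow_Suc[OF q])

section \<open>Recurrence and q-derivatives of the q-Hermite polynomials\<close>

text \<open>These are the Taylor coefficients of Euler's \<open>q\<close>-exponential \<open>(- z; q)\<^sub>\<infinity>\<close>.\<close>

definition qexp_coeff :: "real \<Rightarrow> nat \<Rightarrow> real" where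
  "qexp_coeff q d = q ^ (d choose 2) / qpoch q q d"

text \<open>The polynomial continuation of \<open>x\<^sup>k (x\<inverse>; q)\<^sub>k\<close> to \<open>x = 0\<close>.\<close>

definition qroot_pow :: "real \<Rightarrow> nat \<Rightarrow> real \<Rightarrow> real" where
  "qroot_pow q k x = (\<Prod>i<k. x - q ^ i)"

lemma qexp_coeff_Suc:
  assumes q: "0 < q" "q < 1"
  shows "(1 - q ^ Suc d) * qexp_coeff q (Suc d) = q ^ d * qexp_coeff q d"
proof -
  have "1 - q * q ^ d > 0" using power_Suc_less_one[of q d] q by simp
  then show ?thesis
    using qpoch_q_pos[OF q, of d]
    by (simp add: qexp_coeff_def qpoch_Suc choose_two_Suc power_add field_simps)
qed

lemma qHermite_coeff:
  assumes q: "0 < q" "q < 1" and "k \<le> n"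
  shows "q ^ (n choose 2) * (qpoch (q powi (- int n)) q k / qpoch q q k * (- q) ^ k)
       = qpoch q q n * qexp_coeff q (n - k) / qpoch q q k"
  using assms(3)
proof (induction k)
  case 0
  then show ?case using qpoch_q_pos[OF q, of n] by (simp add: qexp_coeff_def)
next
  case (Suc k)
  define d where "d = n - Suc k"
  have n: "n = Suc (k + d)" "n - k = Suc d" using Suc.prems by (auto simp: d_def)
  have pos: "1 - q * q ^ k > 0" using power_Suc_less_one[of q k] q by simp
  \<comment> \<open>The ratio of consecutive coefficients; the factor \<open>q\<^sup>d\<close> clears the denominator and is cancelled at the end.\<close>
  have c: "(1 - q powi (- int n) * q ^ k) * (- q) * q ^ d = 1 - q ^ Suc d"
  proof -
    have "q powi (- int n) * (q ^ k * q ^ Suc d) = 1"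
      using q unfolding power_int_minus power_int_of_nat
      by (simp add: n(1) power_add field_simps del: of_nat_Suc of_nat_add)
    then show ?thesis by (simp add: algebra_simps)
  qed
  have "q ^ (n choose 2) * (qpoch (q powi (- int n)) q (Suc k) / qpoch q q (Suc k) * (- q) ^ Suc k) * q ^ d
     = (q ^ (n choose 2) * (qpoch (q powi (- int n)) q k / qpoch q q k * (- q) ^ k))
       * ((1 - q powi (- int n) * q ^ k) * (- q) * q ^ d) / (1 - q * q ^ k)"
    by (simp add: qpoch_Suc mult_ac)
  also have "\<dots> = qpoch q q n * ((1 - q ^ Suc d) * qexp_coeff q (Suc d)) / qpoch q q k / (1 - q * q ^ k)"
    unfolding c Suc.IH[OF Suc_leD[OF Suc.prems]] n(2) by (simp add: mult_ac)
  also have "\<dots> = (qpoch q q n * qexp_coeff q d / qpoch q q (Suc k)) * q ^ d"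
    unfolding qexp_coeff_Suc[OF q] by (simp add: qpoch_Suc)
  finally show ?case
    using q by (subst (asm) mult_right_cancel) (auto simp: d_def)
qed

text \<open>In this form, the coefficientwise version of the generating function, both the recurrence
  and the \<open>q\<close>-derivative of \<open>H\<^sub>n\<close> follow from first-order recursions of the two factors.\<close>

lemma qHermite_convolution:
  assumes q: "0 < q" "q < 1"
  shows "poly (qHermite q n) x =
    qpoch q q n * (\<Sum>k\<le>n. qroot_pow q k x / qpoch q q k * qexp_coeff q (n - k))"
proof -
  have "poly (qHermite q n) x = (\<Sum>k\<le>n. q ^ (n choose 2) *
      (qpoch (q powi (- int n)) q k / qpoch q q k * (- q) ^ k) * qroot_pow q k x)"
    by (simp add: qHermite_def poly_sum poly_prod qroot_pow_def sum_distrib_left mult_ac)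
  also have "\<dots> = (\<Sum>k\<le>n. qpoch q q n * qexp_coeff q (n - k) / qpoch q q k * qroot_pow q k x)"
  proof (rule sum.cong[OF refl])
    fix k assume "k \<in> {..n}"
    then have k: "k \<le> n" by simp
    show "q ^ (n choose 2) * (qpoch (q powi - int n) q k / qpoch q q k * (- q) ^ k) * qroot_pow q k x
        = qpoch q q n * qexp_coeff q (n - k) / qpoch q q k * qroot_pow q k x"
      unfolding qHermite_coeff[OF q k] ..
  qed
  finally show ?thesis by (simp add: sum_distrib_left mult_ac)
qed

lemma qHermite_0 [simp]: "qHermite q 0 = 1"
  by (simp add: qHermite_def numeral_2_eq_2)

lemma qHermite_1:
  assumes q: "0 < q" "q < 1"
  shows "qHermite q (Suc 0) = [:0, 1:]"
proof (rule poly_ext)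
  fix x show "poly (qHermite q (Suc 0)) x = poly [:0, 1:] x"
    using q by (simp add: qHermite_convolution[OF q] qroot_pow_def qexp_coeff_def qpoch_def
                 numeral_2_eq_2 flip: add_divide_distrib)
qed

text \<open>The same splitting of \<open>1 - q\<^sup>n\<close> along \<open>n = k + d\<close> as for the \<open>q\<close>-binomial theorem. The
  recursion of the polynomial factor leaves a remainder with \<open>q\<^sup>k\<close> in it; lowering the other index
  once more turns this remainder into the term with \<open>H\<^sub>n\<close>.\<close>

lemma qHermite_recurrence:
  assumes q: "0 < q" "q < 1"
  shows "qHermite q (Suc (Suc n)) =
    [:0, 1:] * qHermite q (Suc n) - smult (q ^ n * (1 - q ^ Suc n)) (qHermite q n)"
proof (rule poly_ext)
  fix x
  define a where "a k = qroot_pow q k x / qpoch q q k" for k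
  define b where "b = qexp_coeff q"
  define u where "u n = (\<Sum>k\<le>n. a k * b (n - k))" for n
  have pos: "1 - q * q ^ k > 0" for k using power_Suc_less_one[of q k] q by simp
  have H: "poly (qHermite q n) x = qpoch q q n * u n" for n
    by (simp add: qHermite_convolution[OF q] u_def a_def b_def)
  have a: "(1 - q ^ Suc k) * a (Suc k) = (x - q ^ k) * a k" for k
    using pos[of k] qpoch_q_pos[OF q, of k]
    by (simp add: a_def qroot_pow_def qpoch_Suc field_simps)
  have b: "(1 - q ^ Suc d) * b (Suc d) = q ^ d * b d" for d
    using qexp_coeff_Suc[OF q] by (simp add: b_def)
  have lower: "(\<Sum>k\<le>Suc m. q ^ k * a k * ((1 - q ^ (Suc m - k)) * b (Suc m - k))) = q ^ m * u m" for m
  proof -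
    have "(\<Sum>k\<le>Suc m. q ^ k * a k * ((1 - q ^ (Suc m - k)) * b (Suc m - k)))
        = (\<Sum>k\<le>m. q ^ k * a k * (q ^ (m - k) * b (m - k)))"
      by (simp add: Suc_diff_le b flip: power_Suc)
    also have "\<dots> = (\<Sum>k\<le>m. q ^ m * (a k * b (m - k)))"
    proof (rule sum.cong[OF refl])
      fix k assume "k \<in> {..m}"
      then have e: "q ^ m = q ^ k * q ^ (m - k)" by (simp flip: power_add)
      show "q ^ k * a k * (q ^ (m - k) * b (m - k)) = q ^ m * (a k * b (m - k))"
        unfolding e by simp
    qed
    finally show ?thesis by (simp add: u_def sum_distrib_left)
  qed
  have upper: "(\<Sum>k\<le>Suc m. (1 - q ^ k) * a k * b (Suc m - k)) = (\<Sum>k\<le>m. (x - q ^ k) * a k * b (m - k))" for m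
    by (subst sum.atMost_Suc_shift) (simp add: a del: power_Suc)
  have "(1 - q ^ Suc (Suc n)) * u (Suc (Suc n)) =
      (\<Sum>k\<le>Suc (Suc n). (1 - q ^ k) * a k * b (Suc (Suc n) - k))
    + (\<Sum>k\<le>Suc (Suc n). q ^ k * a k * ((1 - q ^ (Suc (Suc n) - k)) * b (Suc (Suc n) - k)))"
    unfolding u_def sum_distrib_left sum.distrib[symmetric]
  proof (rule sum.cong[OF refl])
    fix k assume "k \<in> {..Suc (Suc n)}"
    then have "q ^ Suc (Suc n) = q ^ k * q ^ (Suc (Suc n) - k)" by (simp flip: power_add)
    then show "(1 - q ^ Suc (Suc n)) * (a k * b (Suc (Suc n) - k)) =
         (1 - q ^ k) * a k * b (Suc (Suc n) - k) +
         q ^ k * a k * ((1 - q ^ (Suc (Suc n) - k)) * b (Suc (Suc n) - k))"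
      by (simp only:) (simp add: algebra_simps)
  qed
  also have "\<dots> = (\<Sum>k\<le>Suc n. (x - q ^ k) * a k * b (Suc n - k)) + q ^ Suc n * u (Suc n)"
    by (simp only: upper lower)
  also have "(\<Sum>k\<le>Suc n. (x - q ^ k) * a k * b (Suc n - k)) + q ^ Suc n * u (Suc n)
     = x * u (Suc n) - (\<Sum>k\<le>Suc n. q ^ k * a k * ((1 - q ^ (Suc n - k)) * b (Suc n - k)))"
    unfolding u_def sum_distrib_left sum.distrib[symmetric] sum_subtractf[symmetric]
  proof (rule sum.cong[OF refl])
    fix k assume "k \<in> {..Suc n}"
    then have "q ^ Suc n = q ^ k * q ^ (Suc n - k)" by (simp flip: power_add)
    then show "(x - q ^ k) * a k * b (Suc n - k) + q ^ Suc n * (a k * b (Suc n - k)) =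
         x * (a k * b (Suc n - k)) - q ^ k * a k * ((1 - q ^ (Suc n - k)) * b (Suc n - k))"
      by (simp only:) (simp add: algebra_simps)
  qed
  also have "\<dots> = x * u (Suc n) - q ^ n * u n"
    by (simp only: lower)
  finally have rec: "(1 - q ^ Suc (Suc n)) * u (Suc (Suc n)) = x * u (Suc n) - q ^ n * u n" .
  have "poly (qHermite q (Suc (Suc n))) x
      = qpoch q q (Suc n) * ((1 - q ^ Suc (Suc n)) * u (Suc (Suc n)))"
    unfolding H qpoch_Suc[of q q "Suc n"] by (simp add: mult_ac)
  also have "\<dots> = x * (qpoch q q (Suc n) * u (Suc n)) - q ^ n * (1 - q ^ Suc n) * (qpoch q q n * u n)"
    unfolding rec by (simp add: qpoch_Suc algebra_simps)
  finally show "poly (qHermite q (Suc (Suc n))) x =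
     poly ([:0, 1:] * qHermite q (Suc n) - smult (q ^ n * (1 - q ^ Suc n)) (qHermite q n)) x"
    by (simp add: H)
qed

lemma qHermite_monic:
  assumes q: "0 < q" "q < 1"
  shows "degree (qHermite q n) = n \<and> lead_coeff (qHermite q n) = 1"
proof (induction n rule: less_induct)
  case (less n)
  consider "n = 0" | "n = Suc 0" | m where "n = Suc (Suc m)"
    by (metis not0_implies_Suc)
  then show ?case
  proof cases
    case 3
    let ?A = "[:0, 1:] * qHermite q (Suc m)"
    let ?B = "smult (q ^ m * (1 - q ^ Suc m)) (qHermite q m)"
    have IH: "degree (qHermite q (Suc m)) = Suc m" "lead_coeff (qHermite q (Suc m)) = 1"
        "degree (qHermite q m) = m"
      using less.IH[of "Suc m"] less.IH[of m] 3 by auto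
    then have "qHermite q (Suc m) \<noteq> 0" by auto
    then have A: "degree ?A = n" "lead_coeff ?A = 1"
      using IH 3 by (auto simp: degree_mult_eq lead_coeff_mult)
    have B: "degree ?B < n"
      using IH(3) 3 by (metis degree_smult_le le_imp_less_Suc le_Suc_eq)
    have "degree (?A - ?B) = n" "lead_coeff (?A - ?B) = 1"
      using A B degree_add_eq_left[of "- ?B" ?A] lead_coeff_add_le[of "- ?B" ?A]
      by (auto simp: coeff_eq_0)
    then show ?thesis
      unfolding 3 qHermite_recurrence[OF q] by simp
  qed (use q in \<open>auto simp: qHermite_1\<close>)
qed

text \<open>The rule \<open>D\<^sub>q H\<^sub>n\<^sub>+\<^sub>1 = [n + 1]\<^sub>q H\<^sub>n\<close>, multiplied out so that it also makes sense at \<open>x = 0\<close>.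
  It is inherited from the corresponding rule for \<open>qroot_pow\<close>, since the other factor of the
  convolution is constant in \<open>x\<close>.\<close>

lemma qHermite_dilation:
  assumes q: "0 < q" "q < 1"
  shows "poly (qHermite q (Suc n)) (q * x) - poly (qHermite q (Suc n)) x
       = (q ^ Suc n - 1) * x * poly (qHermite q n) x"
proof -
  have root: "qroot_pow q (Suc k) (q * x) - qroot_pow q (Suc k) x = (q ^ Suc k - 1) * x * qroot_pow q k x" for k
  proof -
    have dil: "qroot_pow q (Suc k) (q * x) = q ^ k * (q * x - 1) * qroot_pow q k x" for k
    proof (induction k)
      case (Suc k)
      have "qroot_pow q (Suc (Suc k)) (q * x) = qroot_pow q (Suc k) (q * x) * (q * x - q ^ Suc k)"
        by (simp add: qroot_pow_def)
      also have "\<dots> = q ^ Suc k * (q * x - 1) * (qroot_pow q k x * (x - q ^ k))"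
        unfolding Suc.IH by (simp add: algebra_simps)
      finally show ?case by (simp add: qroot_pow_def)
    qed (simp add: qroot_pow_def)
    show ?thesis unfolding dil by (simp add: qroot_pow_def algebra_simps)
  qed
  have pos: "1 - q * q ^ k > 0" for k using power_Suc_less_one[of q k] q by simp
  let ?b = "qexp_coeff q"
  have "poly (qHermite q (Suc n)) (q * x) - poly (qHermite q (Suc n)) x
     = qpoch q q (Suc n) * (\<Sum>k\<le>Suc n.
         (qroot_pow q k (q * x) - qroot_pow q k x) / qpoch q q k * ?b (Suc n - k))"
    unfolding qHermite_convolution[OF q] right_diff_distrib[symmetric] sum_subtractf[symmetric]
    by (simp add: diff_divide_distrib left_diff_distrib del: sum.atMost_Suc)
  also have "\<dots> = qpoch q q (Suc n) * (\<Sum>k\<le>n.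
         ((q ^ Suc k - 1) * x * qroot_pow q k x) / qpoch q q (Suc k) * ?b (n - k))"
    by (subst sum.atMost_Suc_shift) (simp add: root[simplified] , simp add: qroot_pow_def)
  also have "\<dots> = qpoch q q (Suc n) * (\<Sum>k\<le>n. - x * (qroot_pow q k x / qpoch q q k * ?b (n - k)))"
  proof -
    have "((q ^ Suc k - 1) * x * qroot_pow q k x) / qpoch q q (Suc k) * ?b (n - k)
        = - x * (qroot_pow q k x / qpoch q q k * ?b (n - k))" for k
      using pos[of k] qpoch_q_pos[OF q, of k] by (simp add: qpoch_Suc field_simps)
    then show ?thesis by simp
  qed
  also have "\<dots> = (q ^ Suc n - 1) * x * (qpoch q q n * (\<Sum>k\<le>n. qroot_pow q k x / qpoch q q k * ?b (n - k)))"
    unfolding sum_distrib_left[symmetric] qpoch_Suc by (simp add: algebra_simps)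
  finally show ?thesis by (simp add: qHermite_convolution[OF q])
qed

lemma qderiv_nonzero: "y \<noteq> 0 \<Longrightarrow> qderiv q f y = (f (q * y) - f y) / ((q - 1) * y)"
  by (simp add: qderiv_def)

text \<open>Iterating \<open>D\<^sub>q\<close> at a nonzero point \<open>y\<close> only evaluates difference quotients at the nonzero points
  \<open>q\<^sup>i y\<close>. Linearity therefore holds for arbitrary functions, differentiable at \<open>0\<close> or not.\<close>

lemma qderiv_iter_sum:
  assumes "q \<noteq> 0" "y \<noteq> 0"
  shows "qderiv_iter q k (\<lambda>z. \<Sum>i\<in>A. c i * f i z) y = (\<Sum>i\<in>A. c i * qderiv_iter q k (f i) y)"
  using assms(2)
  by (induction k arbitrary: y)
     (use assms(1) in \<open>simp_all add: qderiv_nonzero sum_subtractf[symmetric] sum_divide_distrib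
        right_diff_distrib diff_divide_distrib\<close>)

lemma qderiv_iter_diff:
  assumes "q \<noteq> 0" "y \<noteq> 0"
  shows "qderiv_iter q k (\<lambda>z. a * f z - b * g z) y
       = a * qderiv_iter q k f y - b * qderiv_iter q k g y"
  using assms(2)
proof (induction k arbitrary: y)
  case (Suc k)
  have arith: "(a * f1 - b * g1 - (a * f0 - b * g0)) / d = a * ((f1 - f0) / d) - b * ((g1 - g0) / d)"
    for f0 f1 g0 g1 d :: real
    by (simp add: diff_divide_distrib right_diff_distrib)
  show ?case
    using Suc.prems assms(1) by (simp add: qderiv_nonzero Suc.IH arith)
qed simp

lemma qfalling_Suc:
  assumes q: "0 < q" "q < 1"
  shows "qfalling q n (Suc k) = qfalling q n k * ((q powi (int n - int k) - 1) / (q - 1))"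
proof -
  have e: "int (Suc k * n) - int (Suc k choose 2) = (int (k * n) - int (k choose 2)) + (int n - int k)"
    by (simp add: choose_two_Suc)
  have "(1 - q powi (- int n) * q ^ k) * q powi (int n - int k) = q powi (int n - int k) - 1"
    using q by (simp add: power_int_diff power_int_minus field_simps)
  then show ?thesis
    unfolding qfalling_def qpoch_Suc e using q
    by (subst power_int_add) (auto simp: field_simps)
qed

text \<open>The integer index, with \<open>H\<^sub>m = 0\<close> for \<open>m < 0\<close>, makes the rule uniform: at \<open>m = 0\<close> the factor
  vanishes, so iterating past the degree needs no separate case.\<close>

lemma qderiv_qHermite_int:
  assumes q: "0 < q" "q < 1" and "y \<noteq> 0"
  shows "qderiv q (poly (qHermite_int q m)) y
       = (q powi m - 1) / (q - 1) * poly (qHermite_int q (m - 1)) y"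
proof -
  consider "m < 0" | "m = 0" | n where "m = int (Suc n)"
    by (metis not_less nat_0_iff not0_implies_Suc nat_eq_iff nle_le)
  then show ?thesis
  proof cases
    case 3
    then have "qHermite_int q m = qHermite q (Suc n)" "qHermite_int q (m - 1) = qHermite q n"
        "q powi m = q ^ Suc n"
      by (auto simp: qHermite_int_def power_int_def nat_add_distrib)
    then show ?thesis
      using assms(3) by (simp add: qderiv_nonzero qHermite_dilation[OF q, simplified])
  qed (use assms(3) in \<open>auto simp: qHermite_int_def qderiv_nonzero\<close>)
qed

lemma qderiv_iter_qHermite:
  assumes q: "0 < q" "q < 1" and "y \<noteq> 0"
  shows "qderiv_iter q k (poly (qHermite q n)) y
       = qfalling q n k * poly (qHermite_int q (int n - int k)) y"
  using assms(3)
proof (induction k arbitrary: y)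
  case 0
  then show ?case by (simp add: qfalling_def qHermite_int_def numeral_2_eq_2)
next
  case (Suc k)
  let ?h = "poly (qHermite_int q (int n - int k))"
  have "qderiv_iter q (Suc k) (poly (qHermite q n)) y = qfalling q n k * qderiv q ?h y"
    using Suc.prems q Suc.IH[of y] Suc.IH[of "q * y"]
    by (simp add: qderiv_nonzero right_diff_distrib)
  also have "qderiv q ?h y = (q powi (int n - int k) - 1) / (q - 1)
      * poly (qHermite_int q (int n - int (Suc k))) y"
    by (subst qderiv_qHermite_int[OF q Suc.prems]) (simp add: algebra_simps)
  finally show ?case
    by (simp add: qfalling_Suc[OF q])
qed


section \<open>The moment functional of the q-Hermite weight\<close>

lemma qpoch_LIMSEQ:
  assumes q: "0 < q" "q < 1"
  shows "(\<lambda>n. qpoch a q n) \<longlonglongrightarrow> qpoch_inf a q"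
    and "convergent_prod (\<lambda>i. 1 - a * q ^ i)"
proof -
  have "summable (\<lambda>i. norm (1 - a * q ^ i - 1))"
    using q by (simp add: abs_mult power_abs summable_mult)
  then show conv: "convergent_prod (\<lambda>i. 1 - a * q ^ i)"
    by (intro abs_convergent_prod_imp_convergent_prod summable_imp_abs_convergent_prod)
  have "(\<lambda>n. qpoch a q (Suc n)) \<longlonglongrightarrow> qpoch_inf a q"
    using convergent_prod_LIMSEQ[OF conv] by (simp add: qpoch_def qpoch_inf_def lessThan_Suc_atMost del: prod.lessThan_Suc)
  then show "(\<lambda>n. qpoch a q n) \<longlonglongrightarrow> qpoch_inf a q"
    by (rule LIMSEQ_imp_Suc)
qed

lemma qpoch_inf_shift:
  assumes q: "0 < q" "q < 1"
  shows "qpoch_inf a q = (1 - a) * qpoch_inf (a * q) q"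
proof (rule LIMSEQ_unique)
  show "(\<lambda>n. qpoch a q (Suc n)) \<longlonglongrightarrow> qpoch_inf a q"
    using qpoch_LIMSEQ(1)[OF q] by (rule LIMSEQ_Suc)
  show "(\<lambda>n. qpoch a q (Suc n)) \<longlonglongrightarrow> (1 - a) * qpoch_inf (a * q) q"
    unfolding qpoch_Suc_shift by (intro tendsto_mult tendsto_const qpoch_LIMSEQ q)
qed

lemma qpoch_inf_pos:
  assumes q: "0 < q" "q < 1" and "a < 1"
  shows "qpoch_inf a q > 0"
proof -
  have pos: "1 - a * q ^ i > 0" for i
  proof (cases "a \<le> 0")
    case True
    then have "a * q ^ i \<le> 0" using q by (simp add: mult_nonpos_nonneg)
    then show ?thesis by simp
  next
    case False
    then have "a * q ^ i \<le> a" using q by (simp add: mult_left_le power_le_one)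
    then show ?thesis using assms(3) by simp
  qed
  have "qpoch_inf a q \<noteq> 0"
    unfolding qpoch_inf_def using pos
    by (intro prodinf_nonzero qpoch_LIMSEQ q) (auto simp: less_le)
  moreover have "qpoch_inf a q \<ge> 0"
    by (rule LIMSEQ_le_const[OF qpoch_LIMSEQ(1)[OF q]])
       (use pos in \<open>auto simp: qpoch_def less_imp_le intro!: prod_nonneg\<close>)
  ultimately show ?thesis by simp
qed

definition qweight :: "real \<Rightarrow> real \<Rightarrow> real" where
  "qweight q x = qpoch_inf (q * x) q * qpoch_inf (- (q * x)) q"

lemma qweight_minus [simp]: "qweight q (- x) = qweight q x"
  by (simp add: qweight_def)

text \<open>The \<open>q\<close>-Pearson equation of the weight: dilation drops the first factor of each infinite product.\<close>

lemma qweight_dilation: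
  assumes q: "0 < q" "q < 1"
  shows "qweight q x = (1 - q\<^sup>2 * x\<^sup>2) * qweight q (q * x)"
  unfolding qweight_def
  by (subst (1 2) qpoch_inf_shift[OF q]) (simp add: algebra_simps power2_eq_square)

lemma qweight_bounds:
  assumes q: "0 < q" "q < 1" and x: "\<bar>x\<bar> \<le> 1"
  shows "0 \<le> qweight q x" "qweight q x \<le> 1"
proof -
  have fac: "0 \<le> 1 - (q * x * q ^ i)\<^sup>2" "1 - (q * x * q ^ i)\<^sup>2 \<le> 1" for i
  proof -
    have "\<bar>q * x * q ^ i\<bar> \<le> 1"
      using q x by (auto simp: abs_mult intro!: mult_le_one power_le_one)
    then show "0 \<le> 1 - (q * x * q ^ i)\<^sup>2" by (simp add: abs_square_le_1)
  qed simp
  have prod: "qpoch (q * x) q n * qpoch (- (q * x)) q n = (\<Prod>i<n. 1 - (q * x * q ^ i)\<^sup>2)" for n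
    unfolding qpoch_def prod.distrib[symmetric]
    by (rule prod.cong) (auto simp: algebra_simps power2_eq_square)
  have lim: "(\<lambda>n. \<Prod>i<n. 1 - (q * x * q ^ i)\<^sup>2) \<longlonglongrightarrow> qweight q x"
    unfolding qweight_def prod[symmetric] by (intro tendsto_mult qpoch_LIMSEQ q)
  show "0 \<le> qweight q x"
    by (rule LIMSEQ_le_const[OF lim]) (use fac in \<open>auto intro!: prod_nonneg\<close>)
  show "qweight q x \<le> 1"
    by (rule LIMSEQ_le_const2[OF lim]) (use fac in \<open>auto intro!: prod_le_1\<close>)
qed

definition qmoment :: "real \<Rightarrow> real poly \<Rightarrow> real" where
  "qmoment q p = jackson_integral q (\<lambda>x. poly p x * qweight q x)"

lemma qmoment_summable:
  assumes q: "0 < q" "q < 1"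
  shows "summable (\<lambda>m. q ^ m * (poly p (q ^ m) * qweight q (q ^ m)
                              + poly p (- (q ^ m)) * qweight q (- (q ^ m))))"
proof -
  have "compact (poly p ` {-1..1})"
    by (intro compact_continuous_image continuous_intros) auto
  then obtain B where "\<forall>x\<in>{-1..1}. \<bar>poly p x\<bar> \<le> B"
    by (auto dest!: compact_imp_bounded simp: bounded_iff)
  then have B: "\<bar>poly p x\<bar> \<le> B" if "x \<in> {-1..1}" for x
    using that by blast
  show ?thesis
  proof (rule summable_comparison_test', rule summable_mult2)
    show "summable (\<lambda>m. q ^ m)" using q by simp
    fix m :: nat
    have m: "0 \<le> q ^ m" "q ^ m \<le> 1" using q by (auto simp: power_le_one)
    have w: "0 \<le> qweight q (q ^ m)" "qweight q (q ^ m) \<le> 1"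
      using qweight_bounds[OF q, of "q ^ m"] m by auto
    have "\<bar>(poly p (q ^ m) + poly p (- (q ^ m))) * qweight q (q ^ m)\<bar> \<le> 2 * B * 1"
      unfolding abs_mult
      using B[of "q ^ m"] B[of "- (q ^ m)"] m w by (intro mult_mono) auto
    then have "q ^ m * \<bar>(poly p (q ^ m) + poly p (- (q ^ m))) * qweight q (q ^ m)\<bar> \<le> q ^ m * (2 * B)"
      using m by (intro mult_left_mono) auto
    then show "norm (q ^ m * (poly p (q ^ m) * qweight q (q ^ m)
              + poly p (- (q ^ m)) * qweight q (- (q ^ m)))) \<le> q ^ m * (2 * B)"
      using m by (simp add: abs_mult distrib_right)
  qed
qed

lemma qmoment_add:
  assumes q: "0 < q" "q < 1"
  shows "qmoment q (p + r) = qmoment q p + qmoment q r"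
  unfolding qmoment_def jackson_integral_def distrib_left[symmetric]
    suminf_add[OF qmoment_summable[OF q] qmoment_summable[OF q]]
  by (simp add: algebra_simps)

lemma qmoment_smult:
  assumes q: "0 < q" "q < 1"
  shows "qmoment q (smult a p) = a * qmoment q p"
proof -
  have "a * qmoment q p = (1 - q) * (a * (\<Sum>m. q ^ m * (poly p (q ^ m) * qweight q (q ^ m)
                              + poly p (- (q ^ m)) * qweight q (- (q ^ m)))))"
    by (simp add: qmoment_def jackson_integral_def)
  also have "\<dots> = qmoment q (smult a p)"
    unfolding suminf_mult[OF qmoment_summable[OF q], symmetric]
    unfolding qmoment_def jackson_integral_def
    by (intro arg_cong[where f = "(*) (1 - q)"] arg_cong[where f = suminf] ext)
       (simp add: algebra_simps)
  finally show ?thesis ..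
qed

lemma qmoment_0 [simp]: "qmoment q 0 = 0"
  by (simp add: qmoment_def jackson_integral_def)

lemma qmoment_diff:
  assumes q: "0 < q" "q < 1"
  shows "qmoment q (p - r) = qmoment q p - qmoment q r"
  using qmoment_add[OF q, of p "smult (-1) r"] qmoment_smult[OF q, of "-1" r] by simp

lemma qmoment_sum:
  assumes q: "0 < q" "q < 1"
  shows "qmoment q (\<Sum>i\<in>A. smult (c i) (f i)) = (\<Sum>i\<in>A. c i * qmoment q (f i))"
  by (induction A rule: infinite_finite_induct) (auto simp: qmoment_add[OF q] qmoment_smult[OF q])

text \<open>Summation by parts, where \<open>r = D\<^sub>q p\<close>: by the difference equation of the weight,
  \<open>(x p - (1 - q) r) w\<close> is up to a factor the \<open>q\<close>-derivative of \<open>g = p (1 - x\<^sup>2) w\<close>, so its Jackson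
  sum telescopes. The boundary terms at \<open>1\<close> and \<open>-1\<close> vanish because of \<open>1 - x\<^sup>2\<close>, and those at \<open>0\<close>
  cancel because \<open>w\<close> is bounded and even and \<open>p\<close> is continuous.\<close>

lemma qmoment_by_parts:
  assumes q: "0 < q" "q < 1"
    and r: "\<And>x. poly p (q * x) - poly p x = (q - 1) * x * poly r x"
  shows "qmoment q ([:0, 1:] * p) = (1 - q) * qmoment q r"
proof -
  define h where "h x = poly ([:0, 1:] * p - smult (1 - q) r) x * qweight q x" for x
  define g where "g x = poly p x * (1 - x\<^sup>2) * qweight q x" for x
  define G where "G m = g (q ^ m) - g (- (q ^ m))" for m
  have gh: "x * h x = g (q * x) - g x" for x
  proof -
    have "g (q * x) = poly p (q * x) * qweight q x"
      unfolding g_def qweight_dilation[OF q, of x] by (simp add: power_mult_distrib)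
    also have "poly p (q * x) = poly p x + (q - 1) * x * poly r x" using r[of x] by simp
    finally show ?thesis by (simp add: h_def g_def algebra_simps power2_eq_square)
  qed
  have "(\<lambda>m. poly p (q ^ m) - poly p (- (q ^ m))) \<longlonglongrightarrow> poly p 0 - poly p (- 0)"
    by (intro tendsto_intros LIMSEQ_realpow_zero) (use q in auto)
  then have lim: "(\<lambda>m. \<bar>poly p (q ^ m) - poly p (- (q ^ m))\<bar>) \<longlonglongrightarrow> 0"
    by (simp add: tendsto_rabs_zero)
  have "G \<longlonglongrightarrow> 0"
  proof (rule Lim_null_comparison[OF always_eventually lim], safe)
    fix m
    have m: "0 \<le> q ^ m" "q ^ m \<le> 1" using q by (auto simp: power_le_one)
    have w: "0 \<le> qweight q (q ^ m)" "qweight q (q ^ m) \<le> 1"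
      using qweight_bounds[OF q, of "q ^ m"] m by auto
    have "(q ^ m)\<^sup>2 \<le> 1" using m by (simp add: power_le_one)
    then have "\<bar>1 - (q ^ m)\<^sup>2\<bar> * \<bar>qweight q (q ^ m)\<bar> \<le> 1 * 1"
      using w by (intro mult_mono) auto
    then have "\<bar>poly p (q ^ m) - poly p (- (q ^ m))\<bar> * (\<bar>1 - (q ^ m)\<^sup>2\<bar> * \<bar>qweight q (q ^ m)\<bar>)
        \<le> \<bar>poly p (q ^ m) - poly p (- (q ^ m))\<bar>"
      by (intro mult_left_le) auto
    moreover have "G m = (poly p (q ^ m) - poly p (- (q ^ m))) * ((1 - (q ^ m)\<^sup>2) * qweight q (q ^ m))"
      by (simp add: G_def g_def algebra_simps)
    ultimately show "norm (G m) \<le> \<bar>poly p (q ^ m) - poly p (- (q ^ m))\<bar>"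
      by (simp add: abs_mult)
  qed
  from telescope_sums[OF this] have "(\<lambda>m. G (Suc m) - G m) sums 0"
    by (simp add: G_def g_def)
  moreover have "G (Suc m) - G m = q ^ m * (h (q ^ m) + h (- (q ^ m)))" for m
    using gh[of "q ^ m"] gh[of "- (q ^ m)"] by (simp add: G_def algebra_simps)
  ultimately have "(\<Sum>m. q ^ m * (h (q ^ m) + h (- (q ^ m)))) = 0"
    by (simp add: sums_iff)
  then have "qmoment q ([:0, 1:] * p - smult (1 - q) r) = 0"
    by (simp only: qmoment_def jackson_integral_def h_def)
  then show ?thesis by (simp add: qmoment_diff[OF q] qmoment_smult[OF q])
qed

lemma qmoment_monom_even:
  assumes q: "0 < q" "q < 1"
  shows "qmoment q (monom 1 (2 * k)) = qpoch q (q\<^sup>2) k * qmoment q 1"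
proof (induction k)
  case (Suc k)
  have "monom 1 (2 * Suc k) = [:0, 1:] * (monom 1 (Suc (2 * k)) :: real poly)"
    by (simp add: monom_Suc)
  also have "qmoment q \<dots> = (1 - q) * qmoment q (smult (qnum q (Suc (2 * k))) (monom 1 (2 * k)))"
    by (rule qmoment_by_parts[OF q])
       (use q in \<open>simp add: poly_monom qnum_def power_mult_distrib field_simps\<close>)
  also have "\<dots> = (1 - q ^ Suc (2 * k)) * qmoment q (monom 1 (2 * k))"
    using q by (simp add: qmoment_smult[OF q] qnum_def)
  finally show ?case
    by (simp add: Suc.IH qpoch_Suc power_mult)
qed (simp add: monom_0 one_pCons)

lemma qpoch_even:
  "qpoch q q (2 * k) = qpoch q (q\<^sup>2) k * (qpoch q q k * qpoch (- q) q k)"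
  by (induction k) (simp_all add: qpoch_Suc power_mult power2_eq_square power_mult_distrib algebra_simps)

text \<open>In the moment of order \<open>2 k\<close> the nodes \<open>q\<^sup>m\<close> with \<open>m > 0\<close> contribute at most a constant times
  \<open>q\<^sup>2\<^sup>k\<close>, so only the nodes \<open>1\<close> and \<open>-1\<close> survive in the limit.\<close>

lemma qmoment_monom_even_LIMSEQ:
  assumes q: "0 < q" "q < 1"
  shows "(\<lambda>k. qmoment q (monom 1 (2 * k))) \<longlonglongrightarrow> 2 * (1 - q) * qweight q 1"
proof -
  define t where "t k m = q ^ m * (poly (monom 1 (2 * k)) (q ^ m) * qweight q (q ^ m)
            + poly (monom 1 (2 * k)) (- (q ^ m)) * qweight q (- (q ^ m)))" for k m
  have t: "t k m = q ^ m * (q ^ m) ^ (2 * k) * (2 * qweight q (q ^ m))" for k m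
    by (simp add: t_def poly_monom)
  have sm: "summable (t k)" for k
    unfolding t_def by (rule qmoment_summable[OF q])
  define R where "R k = (\<Sum>m. t k (Suc m))" for k
  have tail: "\<bar>R k\<bar> \<le> (q\<^sup>2) ^ k * (2 * (1 / (1 - q)))" for k
  proof -
    have "norm (t k (Suc m)) \<le> (q\<^sup>2) ^ k * (2 * q ^ m)" for m
    proof -
      have m: "0 \<le> q ^ m" "q ^ m \<le> 1" "q ^ Suc m \<le> 1"
        using q by (auto simp: power_le_one mult_le_one)
      have w: "0 \<le> qweight q (q ^ Suc m)" "qweight q (q ^ Suc m) \<le> 1"
        using qweight_bounds[OF q, of "q ^ Suc m"] m q by auto
      define u where "u = (q\<^sup>2) ^ k * ((q ^ m * 2) * (q * (q ^ m) ^ (2 * k) * qweight q (q ^ Suc m)))"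
      have "t k (Suc m) = u"
        by (simp add: t u_def power_mult_distrib flip: power_mult)
      moreover have "u \<ge> 0"
        using m w q by (simp add: u_def)
      moreover have "u \<le> (q\<^sup>2) ^ k * ((q ^ m * 2) * 1)"
        unfolding u_def
        using m w q by (intro mult_left_mono mult_le_one) (auto intro!: power_le_one mult_nonneg_nonneg)
      ultimately show ?thesis by (simp add: mult_ac)
    qed
    then have "norm (R k) \<le> (\<Sum>m. (q\<^sup>2) ^ k * (2 * q ^ m))"
      unfolding R_def using q by (intro norm_suminf_le) (auto intro!: summable_mult)
    also have "\<dots> = (q\<^sup>2) ^ k * (2 * (1 / (1 - q)))"
      using q by (simp add: suminf_mult summable_mult suminf_geometric)
    finally show ?thesis by simp
  qed
  have "(\<lambda>k. (q\<^sup>2) ^ k * (2 * (1 / (1 - q)))) \<longlonglongrightarrow> 0"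
    by (intro tendsto_mult_left_zero LIMSEQ_realpow_zero) (use q in \<open>auto simp: power_less_one_iff\<close>)
  then have "R \<longlonglongrightarrow> 0"
    by (rule Lim_null_comparison[OF always_eventually, rotated]) (simp only: real_norm_def tail, simp)
  then have "(\<lambda>k. (1 - q) * (2 * qweight q 1 + R k)) \<longlonglongrightarrow> (1 - q) * (2 * qweight q 1 + 0)"
    by (intro tendsto_intros)
  also have "(1 - q) * (2 * qweight q 1 + 0) = 2 * (1 - q) * qweight q 1"
    by simp
  finally have lim: "(\<lambda>k. (1 - q) * (2 * qweight q 1 + R k)) \<longlonglongrightarrow> 2 * (1 - q) * qweight q 1" .
  have "qmoment q (monom 1 (2 * k)) = (1 - q) * (2 * qweight q 1 + R k)" for k
  proof -
    have "qmoment q (monom 1 (2 * k)) = (1 - q) * (\<Sum>m. t k m)"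
      by (simp add: qmoment_def jackson_integral_def t_def)
    also have "(\<Sum>m. t k m) = t k 0 + R k"
      unfolding R_def using suminf_split_head[OF sm] by simp
    finally show ?thesis by (simp add: t)
  qed
  then show ?thesis using lim by (simp only:)
qed

text \<open>Multiply the formula for the even moments by \<open>(q; q)\<^sub>k (- q; q)\<^sub>k\<close>: by \<open>qpoch_even\<close> the right-hand
  side becomes \<open>(q; q)\<^sub>2\<^sub>k L(1)\<close>. Now both sides have limits, and comparing them gives \<open>L(1)\<close>.\<close>

lemma qmoment_1:
  assumes q: "0 < q" "q < 1"
  shows "qmoment q 1 = qHermite_norm2 q 0"
proof -
  let ?a = "qpoch_inf q q" and ?b = "qpoch_inf (- q) q"
  have "(\<lambda>k. qpoch q q k * qpoch (- q) q k * qmoment q (monom 1 (2 * k)))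
      \<longlonglongrightarrow> ?a * ?b * (2 * (1 - q) * qweight q 1)"
    by (intro tendsto_mult qpoch_LIMSEQ qmoment_monom_even_LIMSEQ q)
  moreover have "qpoch q q k * qpoch (- q) q k * qmoment q (monom 1 (2 * k))
      = qpoch q q (2 * k) * qmoment q 1" for k
    by (simp add: qmoment_monom_even[OF q] qpoch_even)
  ultimately have "(\<lambda>k. qpoch q q (2 * k) * qmoment q 1)
      \<longlonglongrightarrow> ?a * ?b * (2 * (1 - q) * qweight q 1)"
    by (simp only:)
  moreover have "(\<lambda>k. qpoch q q (2 * k) * qmoment q 1) \<longlonglongrightarrow> ?a * qmoment q 1"
    by (intro tendsto_mult tendsto_const
          LIMSEQ_subseq_LIMSEQ[OF qpoch_LIMSEQ(1)[OF q], unfolded o_def]) (auto simp: strict_mono_def)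
  ultimately have "?a * qmoment q 1 = ?a * ?b * (2 * (1 - q) * qweight q 1)"
    using LIMSEQ_unique by blast
  then have "qmoment q 1 = ?b * (2 * (1 - q) * qweight q 1)"
    using qpoch_inf_pos[OF q q(2)] by simp
  also have "\<dots> = qHermite_norm2 q 0"
    using qpoch_inf_shift[OF q, of "-1"]
    by (simp add: qHermite_norm2_def qweight_def numeral_2_eq_2)
  finally show ?thesis .
qed

section \<open>Orthogonality and the Christoffel--Darboux formula\<close>

lemma qHermite_norm2_pos:
  assumes q: "0 < q" "q < 1"
  shows "qHermite_norm2 q n > 0"
  using q qpoch_q_pos[OF q] qpoch_inf_pos[OF q, of q] qpoch_inf_pos[OF q, of "-1"]
    qpoch_inf_pos[OF q, of "-q"]
  by (simp add: qHermite_norm2_def)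

lemma qHermite_norm2_Suc:
  "qHermite_norm2 q (Suc n) = q ^ n * (1 - q ^ Suc n) * qHermite_norm2 q n"
  by (simp add: qHermite_norm2_def qpoch_Suc choose_two_Suc power_add)

text \<open>Summation by parts turns the recurrence into
  \<open>L(H\<^sub>m\<^sub>+\<^sub>2) = (1 - q\<^sup>m\<^sup>+\<^sup>1) (1 - q\<^sup>m) L(H\<^sub>m)\<close>, whose factor vanishes for \<open>m = 0\<close>; thus \<open>L(1)\<close> does not
  propagate to higher even indices.\<close>

lemma qmoment_qHermite:
  assumes q: "0 < q" "q < 1"
  shows "n > 0 \<Longrightarrow> qmoment q (qHermite q n) = 0"
proof (induction n rule: less_induct)
  case (less n)
  from less.prems consider "n = Suc 0" | m where "n = Suc (Suc m)"
    by (metis not0_implies_Suc less_irrefl)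
  then show ?case
  proof cases
    case 1
    have "qmoment q ([:0, 1:] * 1) = (1 - q) * qmoment q 0"
      by (rule qmoment_by_parts[OF q]) simp
    then show ?thesis by (simp add: 1 qHermite_1[OF q])
  next
    case 2
    have "qmoment q ([:0, 1:] * qHermite q (Suc m))
        = (1 - q) * qmoment q (smult (qnum q (Suc m)) (qHermite q m))"
    proof (rule qmoment_by_parts[OF q])
      have "q \<noteq> 1" using q by simp
      then show "poly (qHermite q (Suc m)) (q * x) - poly (qHermite q (Suc m)) x
          = (q - 1) * x * poly (smult (qnum q (Suc m)) (qHermite q m)) x" for x
        unfolding qHermite_dilation[OF q] by (simp add: qnum_mult[symmetric] del: power_Suc)
    qed
    also have "\<dots> = (1 - q ^ Suc m) * qmoment q (qHermite q m)"
      using q by (simp add: qmoment_smult[OF q] qnum_def)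
    finally have "qmoment q (qHermite q n) = (1 - q ^ Suc m) * (1 - q ^ m) * qmoment q (qHermite q m)"
      unfolding 2 qHermite_recurrence[OF q] qmoment_diff[OF q] qmoment_smult[OF q]
      by (simp add: algebra_simps)
    then show ?thesis
      using less.IH[of m] 2 by (cases "m = 0") auto
  qed
qed

text \<open>For \<open>n = 0\<close> the last term vanishes through its factor \<open>1 - q\<^sup>n\<close>, so the truncated \<open>n - 1\<close> is
  harmless and the recurrence needs no case distinction.\<close>

lemma x_mult_qHermite:
  assumes q: "0 < q" "q < 1"
  shows "[:0, 1:] * qHermite q n
       = qHermite q (Suc n) + smult (q ^ (n - 1) * (1 - q ^ n)) (qHermite q (n - 1))"
proof (cases n)
  case 0
  then show ?thesis using qHermite_1[OF q] by simp
next
  case (Suc m)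
  then show ?thesis by (simp add: qHermite_recurrence[OF q])
qed

text \<open>Moving a factor \<open>x\<close> from \<open>H\<^sub>i\<close> to \<open>H\<^sub>n\<close> reduces the first index. The only contributions that do not
  vanish by induction match up because consecutive norms differ exactly by the recurrence
  coefficient.\<close>

lemma qHermite_orthogonal:
  assumes q: "0 < q" "q < 1"
  shows "qmoment q (qHermite q m * qHermite q n) = (if m = n then qHermite_norm2 q n else 0)"
proof (induction m arbitrary: n rule: less_induct)
  case (less m)
  show ?case
  proof (cases "m = 0 \<or> n = 0")
    case True
    then show ?thesis
      by (cases "m = 0"; cases "n = 0") (auto simp: qmoment_1[OF q] qmoment_qHermite[OF q])
  next
    case False
    then obtain i k where Suc: "m = Suc i" and n: "n = Suc k"
      by (metis not0_implies_Suc)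
    let ?H = "qHermite q" and ?c = "\<lambda>n. q ^ (n - 1) * (1 - q ^ n)"
    define X where "X = [:0, 1 :: real:]"
    note rec = x_mult_qHermite[OF q, folded X_def]
    have "?H m = X * ?H i - smult (?c i) (?H (i - 1))"
      unfolding rec Suc by simp
    then have "?H m * ?H n = ?H i * (X * ?H n) - smult (?c i) (?H (i - 1) * ?H n)"
      by (simp add: left_diff_distrib right_diff_distrib mult_ac)
    also have "\<dots> = ?H i * ?H (Suc n) + smult (?c n) (?H i * ?H (n - 1))
        - smult (?c i) (?H (i - 1) * ?H n)"
      unfolding rec by (simp add: distrib_left)
    finally have "qmoment q (?H m * ?H n) = qmoment q (?H i * ?H (Suc n))
        + ?c n * qmoment q (?H i * ?H (n - 1)) - ?c i * qmoment q (?H (i - 1) * ?H n)"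
      by (simp only: qmoment_add[OF q] qmoment_diff[OF q] qmoment_smult[OF q])
    then show ?thesis
      using less.IH[of i] less.IH[of "i - 1"] Suc n
      by (cases i) (auto simp: qHermite_norm2_Suc)
  qed
qed

lemma christoffel_darboux:
  assumes q: "0 < q" "q < 1"
  shows "(x - y) * (\<Sum>k\<le>m. poly (qHermite q k) x / qHermite_norm2 q k * poly (qHermite q k) y)
    = poly (qHermite q (Suc m)) x / qHermite_norm2 q m * poly (qHermite q m) y
    - poly (qHermite q m) x / qHermite_norm2 q m * poly (qHermite q (Suc m)) y"
proof (induction m)
  case 0
  then show ?case by (simp add: qHermite_1[OF q] diff_divide_distrib)
next
  case (Suc m)
  let ?H = "\<lambda>k. poly (qHermite q k)" and ?N = "qHermite_norm2 q"
  have N: "?N m > 0" "?N (Suc m) > 0" using qHermite_norm2_pos[OF q] by auto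
  have c: "q ^ m * (1 - q ^ Suc m) / ?N (Suc m) = 1 / ?N m"
  proof -
    have "q ^ m * (1 - q ^ Suc m) * ?N m \<noteq> 0"
      using N(2) unfolding qHermite_norm2_Suc by linarith
    then show ?thesis unfolding qHermite_norm2_Suc by (simp add: field_simps)
  qed
  have rec: "?H (Suc (Suc m)) z = z * ?H (Suc m) z - q ^ m * (1 - q ^ Suc m) * ?H m z" for z
    unfolding qHermite_recurrence[OF q] by simp
  have "?H (Suc (Suc m)) x / ?N (Suc m) * ?H (Suc m) y - ?H (Suc m) x / ?N (Suc m) * ?H (Suc (Suc m)) y
      = (x - y) * (?H (Suc m) x / ?N (Suc m) * ?H (Suc m) y)
       + (q ^ m * (1 - q ^ Suc m) / ?N (Suc m)) * (?H (Suc m) x * ?H m y - ?H m x * ?H (Suc m) y)"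
    unfolding rec by (simp add: algebra_simps diff_divide_distrib add_divide_distrib)
  also have "\<dots> = (x - y) * (?H (Suc m) x / ?N (Suc m) * ?H (Suc m) y)
      + (?H (Suc m) x / ?N m * ?H m y - ?H m x / ?N m * ?H (Suc m) y)"
    unfolding c by (simp add: algebra_simps diff_divide_distrib)
  finally show ?case
    using Suc.IH by (simp add: distrib_left)
qed

section \<open>Dividing out a linear factor by q-differentiation\<close>

text \<open>The \<open>q\<close>-Leibniz rule for a linear factor: only two terms survive, as for ordinary
  derivatives. At \<open>k = 0\<close> the second term vanishes by \<open>[0]\<^sub>q = 0\<close>.\<close>

lemma qderiv_iter_linear_mult:
  assumes q: "0 < q" "q < 1" and "y \<noteq> 0"
  shows "qderiv_iter q k (\<lambda>z. (x - z) * G z) y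
       = (x - q ^ k * y) * qderiv_iter q k G y - qnum q k * qderiv_iter q (k - 1) G y"
  using assms(3)
proof (induction k arbitrary: y)
  case 0
  then show ?case by (simp add: qnum_def)
next
  case (Suc k)
  define D where "D i = qderiv_iter q i G" for i
  have y: "q * y \<noteq> 0" "(q - 1) * y \<noteq> 0" using Suc.prems q by auto
  have next_deriv: "(q - 1) * y * D (Suc i) y = D i (q * y) - D i y" for i
    using y by (simp add: D_def qderiv_nonzero)
  have lower: "qnum q k * (D (k - 1) (q * y) - D (k - 1) y) = qnum q k * ((q - 1) * y * D k y)"
    using next_deriv[of "k - 1"] by (cases k) (auto simp: qnum_def)
  have num: "(q - 1) * qnum q i = q ^ i - 1" for i
    using q by (simp add: qnum_mult)
  have "(q - 1) * y * qderiv_iter q (Suc k) (\<lambda>z. (x - z) * G z) y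
      = qderiv_iter q k (\<lambda>z. (x - z) * G z) (q * y) - qderiv_iter q k (\<lambda>z. (x - z) * G z) y"
    using y by (simp add: qderiv_nonzero)
  also have "\<dots> = (x - q ^ k * (q * y)) * D k (q * y) - (x - q ^ k * y) * D k y
      - qnum q k * (D (k - 1) (q * y) - D (k - 1) y)"
    using Suc.IH[OF y(1)] Suc.IH[OF Suc.prems] by (simp add: D_def algebra_simps)
  also have "\<dots> = (x - q ^ Suc k * y) * (D k (q * y) - D k y)
      - ((q ^ Suc k - q ^ k) + (q - 1) * qnum q k) * y * D k y"
    unfolding lower by (simp add: algebra_simps)
  also have "(q ^ Suc k - q ^ k) + (q - 1) * qnum q k = (q - 1) * qnum q (Suc k)"
    unfolding num by simp
  also have "(x - q ^ Suc k * y) * (D k (q * y) - D k y) - (q - 1) * qnum q (Suc k) * y * D k y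
      = (q - 1) * y * ((x - q ^ Suc k * y) * D (Suc k) y - qnum q (Suc k) * D k y)"
    unfolding next_deriv[symmetric] by (simp add: algebra_simps)
  finally have "qderiv_iter q (Suc k) (\<lambda>z. (x - z) * G z) y
      = (x - q ^ Suc k * y) * D (Suc k) y - qnum q (Suc k) * D k y"
    using y(2) by (metis mult_left_cancel)
  then show ?case by (simp add: D_def)
qed

text \<open>By the Leibniz rule the \<open>k\<close>-th summand is \<open>T\<^sub>k - T\<^sub>k\<^sub>-\<^sub>1\<close>, where \<open>T\<^sub>k\<close> is \<open>D\<^sub>q\<^sup>k G(y) / [k]\<^sub>q!\<close>
  times the \<open>q\<close>-subtraction power of exponent \<open>k + 1\<close>. This recovers \<open>D\<^sub>q\<^sup>j G\<close> for
  \<open>G = F / (x - y)\<close> from the \<open>q\<close>-derivatives of \<open>F\<close>.\<close>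

lemma qtaylor_linear_mult:
  assumes q: "0 < q" "q < 1" and "y \<noteq> 0"
  shows "(\<Sum>k\<le>j. qderiv_iter q k (\<lambda>z. (x - z) * G z) y / qfact q k * qsub_pow q x y k)
       = qsub_pow q x y (Suc j) * qderiv_iter q j G y / qfact q j"
proof (induction j)
  case 0
  then show ?case by (simp add: qsub_pow_Suc[OF q])
next
  case (Suc j)
  have nz: "qnum q (Suc j) > 0" "qfact q j > 0"
    using qnum_pos[OF q] qfact_pos[OF q] by auto
  show ?case
    unfolding sum.atMost_Suc Suc.IH
    unfolding qderiv_iter_linear_mult[OF assms]
      qsub_pow_Suc[OF q, of x y "Suc j"] qfact_Suc
    using nz by (simp add: field_simps del: funpow.simps)
qed

section \<open>The Fourier expansion of the Sobolev-type polynomials\<close>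

lemma monic_family_spans:
  fixes Q :: "nat \<Rightarrow> real poly"
  assumes Q: "\<And>k. degree (Q k) = k \<and> lead_coeff (Q k) = 1"
    and "\<And>k. k \<ge> n \<Longrightarrow> coeff p k = 0"
  shows "\<exists>c. p = (\<Sum>k<n. smult (c k) (Q k))"
  using assms(2)
proof (induction n arbitrary: p)
  case 0
  then show ?case by (auto intro: poly_eqI)
next
  case (Suc n)
  have "coeff (p - smult (coeff p n) (Q n)) k = 0" if "k \<ge> n" for k
    using Q[of n] Suc.prems[of k] that
    by (cases "k = n") (auto simp: coeff_eq_0)
  from Suc.IH[OF this] obtain c where c: "p - smult (coeff p n) (Q n) = (\<Sum>k<n. smult (c k) (Q k))"
    by auto
  have "p = (\<Sum>k<Suc n. smult ((c(n := coeff p n)) k) (Q k))"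
    using c by (simp add: algebra_simps)
  then show ?case by blast
qed

lemma sobolev_inner_eq:
  "sobolev_inner q \<alpha> lam j f g = qmoment q (f * g)
     + lam * qderiv_iter q j (poly f) \<alpha> * qderiv_iter q j (poly g) \<alpha>"
  by (simp add: sobolev_inner_def qmoment_def qweight_def)

lemma qderiv_iter_poly_sum:
  assumes "q \<noteq> 0" "y \<noteq> 0"
  shows "qderiv_iter q k (poly (\<Sum>i\<in>A. smult (c i) (f i))) y
       = (\<Sum>i\<in>A. c i * qderiv_iter q k (poly (f i)) y)"
  using qderiv_iter_sum[OF assms, where f = "\<lambda>i. poly (f i)" and c = c and A = A and k = k]
  by (simp add: poly_sum[abs_def])

lemma sobolev_inner_sum_right:
  assumes q: "0 < q" "q < 1" and "\<alpha> \<noteq> 0"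
  shows "sobolev_inner q \<alpha> lam j f (\<Sum>i\<in>A. smult (c i) (g i))
       = (\<Sum>i\<in>A. c i * sobolev_inner q \<alpha> lam j f (g i))"
proof -
  have "q \<noteq> 0" using q by simp
  have "f * (\<Sum>i\<in>A. smult (c i) (g i)) = (\<Sum>i\<in>A. smult (c i) (f * g i))"
    by (simp add: sum_distrib_left)
  then show ?thesis
    unfolding sobolev_inner_eq qderiv_iter_poly_sum[OF \<open>q \<noteq> 0\<close> assms(3)]
    by (simp add: qmoment_sum[OF q] sum_distrib_left sum.distrib algebra_simps)
qed

lemma sobolev_type_orthogonal:
  assumes q: "0 < q" "q < 1" and "\<alpha> \<noteq> 0"
    and P: "qHermite_sobolev_type q \<alpha> lam j P" and "k < n"
  shows "sobolev_inner q \<alpha> lam j (P n) (qHermite q k) = 0"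
proof -
  have "\<exists>c. qHermite q k = (\<Sum>i<Suc k. smult (c i) (P i))"
  proof (rule monic_family_spans)
    show "degree (P i) = i \<and> lead_coeff (P i) = 1" for i
      using P unfolding qHermite_sobolev_type_def by blast
  qed (use qHermite_monic[OF q, of k] in \<open>simp add: coeff_eq_0\<close>)
  then obtain c where "qHermite q k = (\<Sum>i<Suc k. smult (c i) (P i))" ..
  moreover have "sobolev_inner q \<alpha> lam j (P n) (P i) = 0" if "i < Suc k" for i
    using P assms(5) that by (auto simp: qHermite_sobolev_type_def)
  ultimately show ?thesis
    by (simp add: sobolev_inner_sum_right[OF q assms(3)] del: sum.lessThan_Suc)
qed

text \<open>Expand \<open>P\<^sub>n - H\<^sub>n\<close> in the \<open>H\<^sub>k\<close> with \<open>k < n\<close>. Since \<open>P\<^sub>n\<close> is Sobolev-orthogonal to \<open>H\<^sub>k\<close>, the moment of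
  \<open>P\<^sub>n H\<^sub>k\<close> is minus the discrete term, which gives every coefficient in terms of
  \<open>D\<^sub>q\<^sup>j P\<^sub>n(\<alpha>)\<close>. Applying \<open>D\<^sub>q\<^sup>j\<close> at \<open>\<alpha>\<close> to the expansion is a linear equation for that unknown, solvable
  because the diagonal kernel is nonnegative.\<close>

lemma sobolev_type_kernel_expansion:
  assumes q: "0 < q" "q < 1" and \<alpha>: "\<alpha> \<noteq> 0" and lam: "lam > 0"
    and P: "qHermite_sobolev_type q \<alpha> lam j P"
  shows "poly (P (Suc m)) x = poly (qHermite q (Suc m)) x
    - lam * (qderiv_iter q j (poly (qHermite q (Suc m))) \<alpha> / (1 + lam * qkernel q m j j \<alpha> \<alpha>))
      * (\<Sum>k\<le>m. poly (qHermite q k) x / qHermite_norm2 q k * qderiv_iter q j (poly (qHermite q k)) \<alpha>)"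
proof -
  define n where "n = Suc m"
  define D where "D p = qderiv_iter q j (poly p) \<alpha>" for p
  let ?H = "qHermite q" and ?N = "qHermite_norm2 q"
  have qnz: "q \<noteq> 0" using q by simp
  have Pn: "degree (P n) = n" "lead_coeff (P n) = 1"
    using P unfolding qHermite_sobolev_type_def by blast+
  have "\<exists>c. P n - ?H n = (\<Sum>k<n. smult (c k) (?H k))"
  proof (rule monic_family_spans)
    show "coeff (P n - ?H n) k = 0" if "k \<ge> n" for k
      using Pn qHermite_monic[OF q, of n] that by (cases "k = n") (auto simp: coeff_eq_0)
  qed (rule qHermite_monic[OF q])
  then obtain c where c: "P n - ?H n = (\<Sum>k<n. smult (c k) (?H k))" ..
  have ck: "c k = - lam * D (P n) * (D (?H k) / ?N k)" if "k < n" for k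
  proof -
    have "P n * ?H k = ?H n * ?H k + (\<Sum>i<n. smult (c i) (?H i * ?H k))"
    proof -
      have "P n = ?H n + (\<Sum>i<n. smult (c i) (?H i))"
        unfolding c[symmetric] by simp
      then show ?thesis
        by (simp only: distrib_right sum_distrib_right mult_smult_left)
    qed
    then have "qmoment q (P n * ?H k) = (\<Sum>i<n. c i * (if i = k then ?N k else 0))"
      using that by (simp add: qmoment_add[OF q] qmoment_sum[OF q] qHermite_orthogonal[OF q])
    also have "\<dots> = c k * ?N k"
      using that by (subst sum.remove[of _ k]) (auto intro!: sum.neutral)
    finally have "c k * ?N k = - lam * D (P n) * D (?H k)"
      using sobolev_type_orthogonal[OF q \<alpha> P that] by (simp add: sobolev_inner_eq D_def)
    then show ?thesis
      using qHermite_norm2_pos[OF q, of k] by (simp add: field_simps)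
  qed
  \<comment> \<open>Extending the coefficients by \<open>1\<close> at \<open>n\<close> makes \<open>P n\<close> itself a single linear combination.\<close>
  define C where "C k = (if k < n then c k else 1)" for k
  have "P n = (\<Sum>k<Suc n. smult (C k) (?H k))"
    using c by (simp add: C_def algebra_simps)
  then have "D (P n) = (\<Sum>k<Suc n. C k * D (?H k))"
    unfolding D_def by (simp only: qderiv_iter_poly_sum[OF qnz \<alpha>])
  also have "\<dots> = D (?H n) + (\<Sum>k<n. - lam * D (P n) * (D (?H k) / ?N k) * D (?H k))"
    by (simp add: C_def ck)
  also have "\<dots> = D (?H n) - lam * D (P n) * qkernel q m j j \<alpha> \<alpha>"
    unfolding qkernel_def n_def lessThan_Suc_atMost D_def[symmetric]
    by (simp add: sum_distrib_left sum_negf mult_ac)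
  finally have "D (P n) * (1 + lam * qkernel q m j j \<alpha> \<alpha>) = D (?H n)"
    by (simp add: algebra_simps)
  moreover have "1 + lam * qkernel q m j j \<alpha> \<alpha> > 0"
  proof -
    have "qkernel q m j j \<alpha> \<alpha> \<ge> 0"
      unfolding qkernel_def
      using qHermite_norm2_pos[OF q] by (intro sum_nonneg) (auto simp: less_imp_le)
    then have "lam * qkernel q m j j \<alpha> \<alpha> \<ge> 0" using lam by simp
    then show ?thesis by simp
  qed
  ultimately have DP: "D (P n) = D (?H n) / (1 + lam * qkernel q m j j \<alpha> \<alpha>)"
    by (simp add: field_simps)
  have "poly (P n) x = poly (?H n) x + (\<Sum>k<n. c k * poly (?H k) x)"
    using arg_cong[OF c, of "\<lambda>p. poly p x"] by (simp add: poly_sum algebra_simps)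
  also have "(\<Sum>k<n. c k * poly (?H k) x)
      = - (lam * D (P n) * (\<Sum>k\<le>m. poly (?H k) x / ?N k * D (?H k)))"
    unfolding sum_distrib_left sum_negf[symmetric] n_def[folded lessThan_Suc_atMost]
      lessThan_Suc_atMost[symmetric]
    by (rule sum.cong) (use ck in \<open>auto simp: n_def mult_ac\<close>)
  finally show ?thesis
    unfolding DP by (simp add: D_def n_def)
qed

text \<open>By the Christoffel--Darboux formula, \<open>F = (x - y) G\<close> for the kernel \<open>G\<close> is a combination of
  \<open>H\<^sub>m\<close> and \<open>H\<^sub>m\<^sub>+\<^sub>1\<close> as a function of \<open>y\<close>; the two \<open>q\<close>-Taylor sums of these are those in
  \<open>calA\<close> and \<open>calB\<close>.\<close>

lemma qderiv_kernel_eq_calA_calB: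
  assumes q: "0 < q" "q < 1" and \<alpha>: "\<alpha> \<noteq> 0" and x: "\<forall>i\<le>j. x \<noteq> q ^ i * \<alpha>"
  shows "(\<Sum>k\<le>m. poly (qHermite q k) x / qHermite_norm2 q k * qderiv_iter q j (poly (qHermite q k)) \<alpha>)
    = calA q j (Suc m) x \<alpha> * poly (qHermite q (Suc m)) x
    + calB q j (Suc m) x \<alpha> * poly (qHermite q m) x"
proof -
  let ?H = "qHermite q" and ?N = "qHermite_norm2 q"
  let ?S = "\<lambda>p. \<Sum>k\<le>j. qderiv_iter q k (poly p) \<alpha> / qfact q k * qsub_pow q x \<alpha> k"
  define G where "G y = (\<Sum>k\<le>m. poly (?H k) x / ?N k * poly (?H k) y)" for y
  define a where "a = poly (?H (Suc m)) x / ?N m"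
  define b where "b = poly (?H m) x / ?N m"
  have qnz: "q \<noteq> 0" using q by simp
  have nz: "qsub_pow q x \<alpha> (Suc j) \<noteq> 0" "qfact q j \<noteq> 0" "?N m \<noteq> 0"
    using qsub_pow_nonzero[OF q] x qfact_pos[OF q, of j] qHermite_norm2_pos[OF q, of m]
    by (auto simp: less_Suc_eq_le less_le)
  have F: "(\<lambda>z. (x - z) * G z) = (\<lambda>z. a * poly (?H m) z - b * poly (?H (Suc m)) z)"
    unfolding G_def a_def b_def christoffel_darboux[OF q] ..
  have "qsub_pow q x \<alpha> (Suc j) * qderiv_iter q j G \<alpha> / qfact q j = a * ?S (?H m) - b * ?S (?H (Suc m))"
    unfolding qtaylor_linear_mult[OF q \<alpha>, symmetric] F qderiv_iter_diff[OF qnz \<alpha>]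
    by (simp add: sum_distrib_left sum_subtractf[symmetric] algebra_simps diff_divide_distrib)
  then have "qderiv_iter q j G \<alpha> = qfact q j / qsub_pow q x \<alpha> (Suc j) * (a * ?S (?H m) - b * ?S (?H (Suc m)))"
    using nz by (simp add: field_simps)
  moreover have "qderiv_iter q j G \<alpha> = (\<Sum>k\<le>m. poly (?H k) x / ?N k * qderiv_iter q j (poly (?H k)) \<alpha>)"
    unfolding G_def by (rule qderiv_iter_sum[OF qnz \<alpha>])
  ultimately show ?thesis
    using nz by (simp add: calA_def calB_def a_def b_def field_simps)
qed

theorem lemma1:
  fixes q \<alpha> lam :: real and j n :: nat and P :: "nat \<Rightarrow> real poly"
  assumes "0 < q" and "q < 1"
    and "\<bar>\<alpha>\<bar> > 1"
    and "lam > 0"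
    and "qHermite_sobolev_type q \<alpha> lam j P"
    and "n \<ge> 1"
  shows "\<forall>x::real. (\<forall>i\<le>j. x \<noteq> q ^ i * \<alpha>) \<longrightarrow>
    poly (P n) x = calE1 q \<alpha> lam j n x * poly (qHermite q n) x
                 + calF1 q \<alpha> lam j n x * poly (qHermite q (n - 1)) x"
proof (intro allI impI)
  fix x assume x: "\<forall>i\<le>j. x \<noteq> q ^ i * \<alpha>"
  have \<alpha>: "\<alpha> \<noteq> 0" using assms(3) by auto
  obtain m where n: "n = Suc m" using assms(6) by (cases n) auto
  show "poly (P n) x = calE1 q \<alpha> lam j n x * poly (qHermite q n) x
                 + calF1 q \<alpha> lam j n x * poly (qHermite q (n - 1)) x"
    unfolding n sobolev_type_kernel_expansion[OF assms(1,2) \<alpha> assms(4,5)]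
      qderiv_kernel_eq_calA_calB[OF assms(1,2) \<alpha> x]
    unfolding qderiv_iter_qHermite[OF assms(1,2) \<alpha>] calE1_def calF1_def
    by (simp add: algebra_simps add_divide_distrib)
qed

end
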